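(* Let $c_{10} = 0.123456789101112131415\ldots$ be the Champernowne constant for base $10$. Then there is a constant $K_1 > 0$ such that for all but finitely many positive integers $N$, $$D(c_{10}, N) < \frac{K_1}{\log N}.$$
   Context: The Champernowne constant $c_{10}\in[0,1)$ is the real number whose decimal expansion is the concatenation, in increasing order, of all positive integers written in base $10$: $c_{10}=0.1\,2\,3\,4\,5\,6\,7\,8\,9\,10\,11\,12\,13\ldots$. For a sequence $(x_n)_{n\ge 1}\subset[0,1)$ and a positive integer $N$, the discrepancy of its first $N$ terms is $$D\left((x_n)_{n\ge 1}, N\right)=\sup_{0\le a<b<1}\left|\frac{\#\{n : x_n\in[a,b),\ 1\le n\le N\}}{N}-(b-a)\right|.$$ For $\alpha\in[0,1)$, its discrepancy for base $10$ is $D(\alpha,N)=D\left((10^{n-1}\alpha \bmod 1)_{n\ge 1}, N\right)$, where $y \bmod 1 = y-\lfloor y\rfloor$ denotes the fractional part of $y$. $\log$ denotes the logarithm in base $10$. *)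

theory Defs
  imports "HOL-Analysis.Analysis"
begin

(* Decimal digits, most significant first. *)
fun dec_digits :: "nat \<Rightarrow> nat list" where
  "dec_digits n = (if n < 10 then [n] else dec_digits (n div 10) @ [n mod 10])"

declare dec_digits.simps [simp del]

(* The k-th entry, counted from 0, of the infinite word 1 2 ... 9 1 0 1 1 1 2 ...
   Each positive integer contributes at least one digit, so the integers 1, ..., k + 1 suffice
   to reach position k; see champernowne_digit_eq. *)
definition champernowne_digit :: "nat \<Rightarrow> nat" where
  "champernowne_digit k = concat (map dec_digits [1..<k + 2]) ! k"

definition champernowne :: real where
  "champernowne = (\<Sum>k. real (champernowne_digit k) / 10 ^ (k + 1))"

(* Sequences are indexed from 1: the value x 0 is never used. *)
definition discrepancy :: "(nat \<Rightarrow> real) \<Rightarrow> nat \<Rightarrow> real" where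
  "discrepancy x N =
     (SUP (a, b) \<in> {(a, b). 0 \<le> a \<and> a < b \<and> b < 1}.
        \<bar>real (card {n \<in> {1..N}. x n \<in> {a..<b}}) / real N - (b - a)\<bar>)"

definition discrepancy_base10 :: "real \<Rightarrow> nat \<Rightarrow> real" where
  "discrepancy_base10 \<alpha> N = discrepancy (\<lambda>n. frac (10 ^ (n - 1) * \<alpha>)) N"

lemma dec_digits_nonempty: "dec_digits n \<noteq> []"
  by (subst dec_digits.simps) simp

lemma set_dec_digits: "d \<in> set (dec_digits n) \<Longrightarrow> d < 10"
proof (induction n rule: dec_digits.induct)
  case (1 n)
  then show ?case
    by (subst (asm) (2) dec_digits.simps) (auto split: if_splits)
qed

lemma length_concat_dec_digits: "length xs \<le> length (concat (map dec_digits xs))"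
proof (induction xs)
  case (Cons a xs)
  have "1 \<le> length (dec_digits a)"
    using dec_digits_nonempty[of a] by (cases "dec_digits a") auto
  with Cons show ?case by simp
qed simp

lemma champernowne_digit_eq:
  assumes "k < m"
  shows "champernowne_digit k = concat (map dec_digits [1..<m + 1]) ! k"
proof -
  have "[1..<m + 1] = [1..<k + 2] @ [k + 2..<m + 1]"
    using upt_add_eq_append[of 1 "k + 2" "m - 1 - k"] assms by simp
  moreover have "k < length (concat (map dec_digits [1..<k + 2]))"
    using length_concat_dec_digits[of "[1..<k + 2]"] unfolding length_upt by linarith
  ultimately show ?thesis
    unfolding champernowne_digit_def by (simp only: map_append concat_append nth_append if_True)
qed

lemma champernowne_digit_less: "champernowne_digit k < 10"
proof -
  have "k < length (concat (map dec_digits [1..<k + 2]))"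
    using length_concat_dec_digits[of "[1..<k + 2]"] unfolding length_upt by linarith
  from nth_mem[OF this] show ?thesis
    unfolding champernowne_digit_def using set_dec_digits by (auto simp del: upt_Suc)
qed

lemma summable_champernowne: "summable (\<lambda>k. real (champernowne_digit k) / 10 ^ (k + 1))"
proof (rule summable_comparison_test')
  show "summable (\<lambda>k. (1 / 10 :: real) ^ k)" by (rule summable_geometric) simp
  show "norm (real (champernowne_digit k) / 10 ^ (k + 1)) \<le> (1 / 10) ^ k" for k
    using champernowne_digit_less[of k] by (simp add: power_one_over field_simps)
qed

lemma bdd_above_discrepancy:
  "bdd_above ((\<lambda>(a, b). \<bar>real (card {n \<in> {1..N}. x n \<in> {a..<b}}) / real N - (b - a)\<bar>)
     ` {(a, b). 0 \<le> a \<and> a < b \<and> b < (1::real)})"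
proof (rule bdd_aboveI2, clarify)
  fix a b :: real
  assume ab: "0 \<le> a" "a < b" "b < 1"
  have "card {n \<in> {1..N}. x n \<in> {a..<b}} \<le> card {1..N}"
    by (rule card_mono) auto
  then have "real (card {n \<in> {1..N}. x n \<in> {a..<b}}) / real N \<le> 1"
    by (cases "N = 0") auto
  moreover have "0 \<le> real (card {n \<in> {1..N}. x n \<in> {a..<b}}) / real N" by simp
  ultimately show "\<bar>real (card {n \<in> {1..N}. x n \<in> {a..<b}}) / real N - (b - a)\<bar> \<le> 1"
    using ab by linarith
qed

end

theory Submission
  imports Defs
begin

text \<open>
  Write \<open>x k\<close> for the fractional part of \<open>10 ^ k\<close> times the Champernowne constant, and \<open>l n\<close> for
  the number of decimal digits of \<open>n\<close>. The positions of the word \<open>1 2 3 ...\<close> are classified by the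
  number \<open>r\<close> of digits that remain, from the position on, in the integer \<open>n\<close> to which it belongs.
  At such a position \<open>x k = (n mod 10 ^ r + y) / 10 ^ r\<close> for some \<open>0 \<le> y < 1\<close>
  (\<open>expansion_tail_in_block\<close>). Whatever \<open>y\<close> is, \<open>n mod 10 ^ r\<close>
  decides whether \<open>x k < t\<close> holds, except for one residue class.

  For fixed \<open>r\<close>, the integers below \<open>B\<close> that have such a position are the consecutive ones in
  \<open>[10 ^ (r - 1), B)\<close>, and consecutive integers are equidistributed modulo \<open>10 ^ r\<close> up to an incomplete
  period. So, for each \<open>r\<close>, the number of points in \<open>[0, t)\<close> differs from its expected value by
  \<open>O(10 ^ r + B / 10 ^ r)\<close> (\<open>perturbed_residues_deviation\<close>). Both terms form geometric series
  in \<open>r \<le> l B\<close>, and \<open>10 ^ l B \<le> 10 * B\<close>; hence the total deviation over all integers below \<open>B\<close> is \<open>O(B)\<close>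
  (\<open>deviation_at_block_start\<close>), uniformly in \<open>t\<close>.

  The integers below \<open>B\<close> occupy about \<open>B\<close> times \<open>l B\<close> positions (\<open>block_start_lower\<close>), and the log of
  that number is of order \<open>l B\<close>. Dividing the deviation by the number of positions therefore
  leaves \<open>O(1 / log N)\<close>.
\<close>

section \<open>Decimal digits\<close>

abbreviation num_digits :: "nat \<Rightarrow> nat" where
  "num_digits n \<equiv> length (dec_digits n)"

lemma num_digits_pos: "0 < num_digits n"
  using dec_digits_nonempty by simp

lemma num_digits_upper: "n < 10 ^ num_digits n"
proof (induction n rule: dec_digits.induct)
  case (1 n)
  show ?case
  proof (cases "n < 10")
    case True
    then show ?thesis by (subst dec_digits.simps) simp
  next
    case False
    then have "n div 10 < 10 ^ num_digits (n div 10)" using 1 by blast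
    then have "n < 10 ^ num_digits (n div 10) * 10"
      by (simp add: div_less_iff_less_mult)
    then show ?thesis using False by (subst dec_digits.simps) simp
  qed
qed

lemma num_digits_lower: "0 < n \<Longrightarrow> 10 ^ (num_digits n - 1) \<le> n"
proof (induction n rule: dec_digits.induct)
  case (1 n)
  show ?case
  proof (cases "n < 10")
    case True
    then show ?thesis using 1 by (subst dec_digits.simps) simp
  next
    case False
    then have "10 ^ (num_digits (n div 10) - 1) \<le> n div 10" using 1 by force
    then have "10 * 10 ^ (num_digits (n div 10) - 1) \<le> n" by linarith
    then have "10 ^ num_digits (n div 10) \<le> n"
      using power_minus_mult[OF num_digits_pos, of "10::nat" "n div 10"] by (simp add: mult.commute)
    then show ?thesis using False by (subst dec_digits.simps) simp
  qed
qed

lemma less_num_digits_iff: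
  assumes "0 < n"
  shows "r < num_digits n \<longleftrightarrow> 10 ^ r \<le> n"
proof
  assume "r < num_digits n"
  then have "(10::nat) ^ r \<le> 10 ^ (num_digits n - 1)" by (intro power_increasing) auto
  with num_digits_lower[OF assms] show "10 ^ r \<le> n" by linarith
next
  assume "10 ^ r \<le> n"
  then have "(10::nat) ^ r < 10 ^ num_digits n" using num_digits_upper[of n] by linarith
  then show "r < num_digits n" by simp
qed

lemma num_digits_mono:
  assumes "m \<le> n" and "0 < m"
  shows "num_digits m \<le> num_digits n"
  using less_num_digits_iff[of m] less_num_digits_iff[of n] assms
  by (meson leI le_trans less_irrefl less_le_trans)

lemma num_digits_le_self:
  assumes "0 < n"
  shows "num_digits n \<le> n"
proof -
  have "num_digits n - 1 < 10 ^ (num_digits n - 1)"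
    by (rule less_exp[THEN less_le_trans]) (simp add: power_mono)
  with num_digits_lower[OF assms] show ?thesis by linarith
qed

lemma dec_digits_nth_from_end:
  "r < num_digits n \<Longrightarrow> dec_digits n ! (num_digits n - Suc r) = n div 10 ^ r mod 10"
proof (induction n arbitrary: r rule: dec_digits.induct)
  case (1 n)
  show ?case
  proof (cases "n < 10")
    case True
    then have "dec_digits n = [n]" by (subst dec_digits.simps) simp
    then show ?thesis using 1 True by simp
  next
    case False
    then have eq: "dec_digits n = dec_digits (n div 10) @ [n mod 10]"
      by (subst dec_digits.simps) simp
    show ?thesis
    proof (cases r)
      case 0
      then show ?thesis by (simp add: eq nth_append)
    next
      case (Suc s)
      then have s: "s < num_digits (n div 10)" using "1.prems" by (simp add: eq)
      with "1.IH"[OF False this] show ?thesis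
        by (simp add: eq nth_append Suc div_mult2_eq)
    qed
  qed
qed

section \<open>The blocks of the Champernowne word\<close>

definition block_start :: "nat \<Rightarrow> nat" where
  "block_start n = (\<Sum>i\<in>{1..<n}. num_digits i)"

lemma block_start_Suc: "0 < n \<Longrightarrow> block_start (Suc n) = block_start n + num_digits n"
  unfolding block_start_def by simp

lemma block_start_1: "block_start (Suc 0) = 0"
  unfolding block_start_def by simp

lemma le_block_start_Suc: "n \<le> block_start (Suc n)"
proof (induction n)
  case (Suc n)
  then show ?case using num_digits_pos[of "Suc n"] block_start_Suc[of "Suc n"] by linarith
qed simp

lemma length_concat_eq_block_start:
  "length (concat (map dec_digits [1..<n])) = block_start n"
  unfolding block_start_def
  by (simp add: length_concat o_def interv_sum_list_conv_sum_set_nat)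

lemma champernowne_digit_block:
  assumes "0 < n" and "j < num_digits n"
  shows "champernowne_digit (block_start n + j) = dec_digits n ! j"
proof -
  define m where "m = Suc (block_start n + j) + n"
  have up: "[1..<m + 1] = [1..<n] @ n # [Suc n..<m + 1]"
  proof -
    have "[1..<m + 1] = [1..<n] @ [n..<m + 1]"
      using assms upt_add_eq_append[of 1 n "m + 1 - n"] unfolding m_def
      by (simp del: upt_Suc add: add_ac)
    moreover have "[n..<m + 1] = n # [Suc n..<m + 1]"
      by (rule upt_conv_Cons) (simp add: m_def)
    ultimately show ?thesis by (simp only:)
  qed
  have "champernowne_digit (block_start n + j)
      = concat (map dec_digits [1..<m + 1]) ! (block_start n + j)"
    by (rule champernowne_digit_eq) (simp add: m_def)
  also have "\<dots> = (concat (map dec_digits [1..<n]) @ dec_digits n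
      @ concat (map dec_digits [Suc n..<m + 1])) ! (block_start n + j)"
    unfolding up by simp
  also have "\<dots> = dec_digits n ! j"
    using assms unfolding nth_append length_concat_eq_block_start by simp
  finally show ?thesis .
qed

lemma sum_over_blocks:
  fixes f :: "nat \<Rightarrow> real"
  assumes "0 < B"
  shows "(\<Sum>k<block_start B. f k)
    = (\<Sum>n\<in>{1..<B}. \<Sum>r<num_digits n. f (block_start (Suc n) - Suc r))"
  using assms
proof (induction B)
  case (Suc B)
  show ?case
  proof (cases "B = 0")
    case True
    then show ?thesis by (simp add: block_start_1)
  next
    case False
    let ?s = "block_start B" and ?l = "num_digits B"
    have "(\<Sum>k<block_start (Suc B). f k) = (\<Sum>k<?s. f k) + (\<Sum>j<?l. f (?s + j))"
      using False sum.atLeastLessThan_concat[of 0 ?s "?s + ?l" f] sum.shift_bounds_nat_ivl[of f 0 ?s ?l]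
      by (simp add: block_start_Suc atLeast0LessThan add.commute)
    also have "(\<Sum>j<?l. f (?s + j)) = (\<Sum>r<?l. f (?s + (?l - Suc r)))"
      using sum.nat_diff_reindex[of "\<lambda>j. f (?s + j)" ?l] by simp
    also have "\<dots> = (\<Sum>r<?l. f (block_start (Suc B) - Suc r))"
      using False by (intro sum.cong) (auto simp: block_start_Suc)
    finally show ?thesis using Suc False by simp
  qed
qed simp

text \<open>For fixed \<open>r\<close> the relevant integers are consecutive; this is what makes summing over them first
  profitable.\<close>

lemma sum_over_blocks_swap:
  fixes g :: "nat \<Rightarrow> nat \<Rightarrow> real"
  shows "(\<Sum>n\<in>{1..<B}. \<Sum>r<num_digits n. g n r)
    = (\<Sum>r<num_digits B. \<Sum>n\<in>{10 ^ r..<B}. g n r)"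
proof -
  have "(\<Sum>n\<in>{1..<B}. \<Sum>r<num_digits n. g n r)
      = (\<Sum>n\<in>{1..<B}. \<Sum>r\<in>{r \<in> {..<num_digits B}. r < num_digits n}. g n r)"
  proof (intro sum.cong refl)
    fix n assume "n \<in> {1..<B}"
    then have "num_digits n \<le> num_digits B" by (intro num_digits_mono) auto
    then show "{..<num_digits n} = {r \<in> {..<num_digits B}. r < num_digits n}" by auto
  qed
  also have "\<dots> = (\<Sum>r<num_digits B. \<Sum>n\<in>{n \<in> {1..<B}. r < num_digits n}. g n r)"
    by (rule sum.swap_restrict) auto
  also have "\<dots> = (\<Sum>r<num_digits B. \<Sum>n\<in>{10 ^ r..<B}. g n r)"
  proof (intro sum.cong refl)
    fix r
    have "0 < n" if "10 ^ r \<le> n" for n :: nat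
      using that by (meson less_le_trans zero_less_numeral zero_less_power)
    then show "{n \<in> {1..<B}. r < num_digits n} = {10 ^ r..<B}"
      by (auto simp: less_num_digits_iff Suc_le_eq)
  qed
  finally show ?thesis .
qed

lemma sum_powers_10: "9 * (\<Sum>r<R. (10::real) ^ r) = 10 ^ R - 1"
  by (induction R) (auto simp: algebra_simps)

lemma power_num_digits_le:
  assumes "0 < B"
  shows "(10::real) ^ num_digits B \<le> 10 * real B"
proof -
  have "(10::nat) ^ num_digits B \<le> 10 * B"
    using num_digits_lower[OF assms] power_minus_mult[OF num_digits_pos, of "10::nat" B]
    by (simp add: mult.commute)
  then have "real (10 ^ num_digits B) \<le> real (10 * B)" by (simp only: of_nat_le_iff)
  then show ?thesis by simp
qed

text \<open>Every \<open>r < num_digits B\<close> is counted by all but \<open>10 ^ r\<close> of the integers below \<open>B\<close>, and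
  these exceptions form a geometric series dominated by its last term, which is at most \<open>B\<close>.\<close>

lemma block_start_lower:
  assumes "0 < B"
  shows "(real (num_digits B) - 2) * real B \<le> real (block_start B)"
proof -
  have "real (block_start B) = (\<Sum>n\<in>{1..<B}. \<Sum>r<num_digits n. 1)"
    unfolding block_start_def by simp
  also have "\<dots> = (\<Sum>r<num_digits B. \<Sum>n\<in>{10 ^ r..<B}. 1)"
    by (rule sum_over_blocks_swap)
  also have "\<dots> = (\<Sum>r<num_digits B. real B - 10 ^ r)"
    using assms by (intro sum.cong) (auto simp: less_num_digits_iff of_nat_diff)
  also have "\<dots> = real (num_digits B) * real B - (\<Sum>r<num_digits B. 10 ^ r)"
    by (simp add: sum_subtractf)
  finally show ?thesis
    using sum_powers_10[of "num_digits B"] power_num_digits_le[OF assms] assms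
    by (simp add: algebra_simps)
qed

lemma block_start_upper:
  assumes "0 < B"
  shows "block_start (Suc B) \<le> B * num_digits B"
proof -
  have "block_start (Suc B) \<le> (\<Sum>n\<in>{1..<Suc B}. num_digits B)"
    unfolding block_start_def using assms by (intro sum_mono num_digits_mono) auto
  then show ?thesis by simp
qed

lemma obtain_block:
  obtains B where "0 < B" "block_start B \<le> N" "N < block_start (Suc B)"
proof -
  define B where "B = (LEAST B. N < block_start (Suc B))"
  have "N < block_start (Suc (Suc N))"
    using le_block_start_Suc[of "Suc N"] by linarith
  then have up: "N < block_start (Suc B)" unfolding B_def by (rule LeastI)
  then have pos: "0 < B" using block_start_1 by (cases B) auto
  have "\<not> N < block_start (Suc (B - 1))"
    using pos unfolding B_def by (intro not_less_Least) simp
  then have "block_start B \<le> N" using pos by simp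
  with pos up that show ?thesis by blast
qed

section \<open>Shifts of the Champernowne constant\<close>

definition expansion_tail :: "nat \<Rightarrow> real" where
  "expansion_tail k = (\<Sum>i. real (champernowne_digit (k + i)) / 10 ^ (i + 1))"

lemma summable_expansion_tail: "summable (\<lambda>i. real (champernowne_digit (k + i)) / 10 ^ (i + 1))"
proof (rule summable_comparison_test')
  show "summable (\<lambda>i. (1 / 10 :: real) ^ i)" by (rule summable_geometric) simp
  show "norm (real (champernowne_digit (k + i)) / 10 ^ (i + 1)) \<le> (1 / 10) ^ i" for i
    using champernowne_digit_less[of "k + i"] by (simp add: power_one_over field_simps)
qed

lemma expansion_tail_step: "10 * expansion_tail k = real (champernowne_digit k) + expansion_tail (Suc k)"
proof -
  let ?f = "\<lambda>i. real (champernowne_digit (k + i)) / 10 ^ (i + 1)"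
  have "expansion_tail k = ?f 0 + (\<Sum>i. ?f (Suc i))"
    unfolding expansion_tail_def using suminf_split_head[OF summable_expansion_tail[of k]] by simp
  also have "(\<Sum>i. ?f (Suc i)) = (\<Sum>i. real (champernowne_digit (Suc k + i)) / 10 ^ (i + 1) / 10)"
    by (simp add: mult.commute)
  also have "\<dots> = expansion_tail (Suc k) / 10"
    unfolding expansion_tail_def by (rule suminf_divide[OF summable_expansion_tail])
  finally show ?thesis by simp
qed

lemma expansion_tail_nonneg: "0 \<le> expansion_tail k"
  unfolding expansion_tail_def by (rule suminf_nonneg[OF summable_expansion_tail]) simp

text \<open>Strictness means that the expansion does not end in nines: the power \<open>10 ^ k\<close> begins
  with the digit 1, at a position not before \<open>k\<close>.\<close>

lemma expansion_tail_less_1: "expansion_tail k < 1"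
proof -
  define p where "p = block_start (10 ^ k)"
  have "k \<le> p"
  proof -
    have "k < (10::nat) ^ k" by (rule less_exp[THEN less_le_trans]) (simp add: power_mono)
    then have "k \<le> 10 ^ k - 1" by simp
    also have "\<dots> \<le> block_start (Suc (10 ^ k - 1))" by (rule le_block_start_Suc)
    finally show ?thesis unfolding p_def by simp
  qed
  have len: "num_digits (10 ^ k) = Suc k"
    using less_num_digits_iff[of "10 ^ k" k] less_num_digits_iff[of "10 ^ k" "Suc k"] by simp
  have "champernowne_digit p = dec_digits (10 ^ k) ! 0"
    using champernowne_digit_block[of "10 ^ k" 0] len unfolding p_def by simp
  also have "\<dots> = 1" using dec_digits_nth_from_end[of k "10 ^ k"] len by simp
  finally have dig: "champernowne_digit p = 1" .
  let ?d = "\<lambda>i. real (champernowne_digit (k + i)) / 10 ^ (i + 1)"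
  let ?g = "\<lambda>i. 9 / 10 * (1 / 10 :: real) ^ i"
  have nines: "?g sums 1"
    using sums_mult[OF geometric_sums[of "1 / 10 :: real"], of "9 / 10"] by simp
  have diff: "(\<lambda>i. ?g i - ?d i) sums (1 - expansion_tail k)"
    unfolding expansion_tail_def
    by (intro sums_diff nines summable_sums summable_expansion_tail)
  have "0 < (\<Sum>i. ?g i - ?d i)"
  proof (rule suminf_pos2)
    show "summable (\<lambda>i. ?g i - ?d i)" using diff by (rule sums_summable)
    show "0 \<le> ?g i - ?d i" for i
      using champernowne_digit_less[of "k + i"] by (simp add: power_one_over field_simps)
    show "0 < ?g (p - k) - ?d (p - k)"
      using dig \<open>k \<le> p\<close> by (simp add: power_one_over field_simps)
  qed
  then show ?thesis using sums_unique[OF diff] by simp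
qed

lemma frac_shift_champernowne: "frac (10 ^ k * champernowne) = expansion_tail k"
proof -
  have "10 ^ k * champernowne - expansion_tail k \<in> \<int>"
  proof (induction k)
    case 0
    then show ?case unfolding champernowne_def expansion_tail_def by simp
  next
    case (Suc k)
    have "10 ^ Suc k * champernowne - expansion_tail (Suc k)
        = 10 * (10 ^ k * champernowne - expansion_tail k) + real (champernowne_digit k)"
      using expansion_tail_step[of k] by (simp add: algebra_simps)
    moreover have "10 * (10 ^ k * champernowne - expansion_tail k) \<in> \<int>"
      using Suc by (intro Ints_mult) auto
    ultimately show ?case by (simp only:) (intro Ints_add, auto)
  qed
  then show ?thesis
    using expansion_tail_nonneg expansion_tail_less_1 by (simp add: frac_unique_iff)
qed

text \<open>Reading the expansion from a position \<open>r\<close> digits before the end of the block of \<open>n\<close> gives first the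
  last \<open>r\<close> digits of \<open>n\<close>, that is \<open>n mod 10 ^ r\<close>, and then the following blocks.\<close>

lemma expansion_tail_in_block:
  assumes "0 < n" and "r \<le> num_digits n"
  shows "10 ^ r * expansion_tail (block_start (Suc n) - r)
    = real (n mod 10 ^ r) + expansion_tail (block_start (Suc n))"
  using assms(2)
proof (induction r)
  case (Suc r)
  let ?k = "block_start (Suc n) - Suc r"
  have k: "?k = block_start n + (num_digits n - Suc r)" "Suc ?k = block_start (Suc n) - r"
    using Suc.prems block_start_Suc[OF assms(1)] by auto
  have dig: "champernowne_digit ?k = n div 10 ^ r mod 10"
    using champernowne_digit_block[OF assms(1), of "num_digits n - Suc r"]
      dec_digits_nth_from_end[of r n] Suc.prems unfolding k(1) by simp
  have md: "n mod 10 ^ Suc r = 10 ^ r * (n div 10 ^ r mod 10) + n mod 10 ^ r"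
    using mod_mult2_eq[of n "10 ^ r" 10] by (simp add: mult.commute)
  have "10 ^ Suc r * expansion_tail ?k = 10 ^ r * (10 * expansion_tail ?k)" by simp
  also have "\<dots> = 10 ^ r * real (n div 10 ^ r mod 10) + 10 ^ r * expansion_tail (block_start (Suc n) - r)"
    unfolding expansion_tail_step dig k(2) by (simp add: distrib_left)
  also have "\<dots> = real (n mod 10 ^ Suc r) + expansion_tail (block_start (Suc n))"
    unfolding md using Suc by simp
  finally show ?case .
qed simp

section \<open>Residues of consecutive integers\<close>

lemma count_small_residues:
  fixes T Q B :: nat
  assumes "0 < Q" and "T \<le> Q"
  shows "(\<Sum>n<B. of_bool (n mod Q < T)) = B div Q * T + min (B mod Q) T"
proof (induction B)
  case (Suc B)
  have "B mod Q < Q" using assms by simp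
  then show ?case using Suc assms by (auto simp: div_Suc mod_Suc min_def)
qed simp

lemma count_small_residues_deviation:
  fixes T Q A B :: nat
  assumes "0 < Q" and "T \<le> Q" and "A \<le> B"
  shows "\<bar>(\<Sum>n\<in>{A..<B}. of_bool (n mod Q < T)) - real (B - A) * real T / real Q\<bar> \<le> 2 * real Q"
proof -
  define G :: "nat \<Rightarrow> real" where "G C = (\<Sum>n<C. of_bool (n mod Q < T))" for C
  have G: "\<bar>G C - real C * real T / real Q\<bar> \<le> real Q" for C
  proof -
    have "G C = real (\<Sum>n<C. of_bool (n mod Q < T))" unfolding G_def by simp
    then have "G C = real (C div Q) * real T + real (min (C mod Q) T)"
      unfolding count_small_residues[OF assms(1,2)] by simp
    moreover have "real C = real (C div Q) * real Q + real (C mod Q)"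
      by (metis div_mult_mod_eq of_nat_add of_nat_mult)
    ultimately have "G C - real C * real T / real Q
        = real (min (C mod Q) T) - real (C mod Q) * real T / real Q"
      using assms(1) by (simp add: field_simps)
    moreover have "0 \<le> real (C mod Q) * real T / real Q" by simp
    moreover have "real (C mod Q) * real T / real Q \<le> real Q"
    proof -
      have "real (C mod Q) * real T \<le> real Q * real Q"
        using assms by (intro mult_mono) (auto intro: less_imp_le)
      then show ?thesis using assms by (simp add: field_simps)
    qed
    moreover have "0 \<le> real (min (C mod Q) T)" "real (min (C mod Q) T) \<le> real Q"
      using assms by auto
    ultimately show ?thesis by linarith
  qed
  have "(\<Sum>n\<in>{A..<B}. of_bool (n mod Q < T)) = G B - G A"
    unfolding G_def using sum_diff_nat_ivl[of 0 A B "\<lambda>n. of_bool (n mod Q < T) :: real"] assms(3)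
    by (simp add: atLeast0LessThan)
  moreover have "real (B - A) * real T / real Q = real B * real T / real Q - real A * real T / real Q"
    using assms(3) by (simp add: of_nat_diff diff_divide_distrib left_diff_distrib)
  ultimately show ?thesis using G[of A] G[of B] by linarith
qed

text \<open>The perturbations \<open>y n\<close> are arbitrary in \<open>[0, 1)\<close>: with \<open>T\<close> the integer part of \<open>t\<close> times \<open>Q\<close>, the
  condition on \<open>n\<close> lies between \<open>n mod Q < T\<close> and \<open>n mod Q < T + 1\<close>, so they cost at
  most one residue class.\<close>

lemma perturbed_residues_deviation:
  fixes Q A B :: nat and t :: real and y :: "nat \<Rightarrow> real"
  assumes "0 < Q" and "A \<le> B" and "0 \<le> t" and "t < 1"
    and y: "\<And>n. 0 \<le> y n" "\<And>n. y n < 1"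
  shows "\<bar>\<Sum>n\<in>{A..<B}. of_bool ((real (n mod Q) + y n) / real Q < t) - t\<bar>
    \<le> 2 * real Q + real B / real Q"
proof -
  define T where "T = nat \<lfloor>t * real Q\<rfloor>"
  have T: "real T \<le> t * real Q" "t * real Q < real T + 1"
    unfolding T_def using assms(1,3) by (simp_all add: of_nat_nat)
  have "t * real Q < real Q" using assms(1,4) by simp
  with T have "real T < real Q" by linarith
  then have TQ: "Suc T \<le> Q" by simp
  let ?S = "\<Sum>n\<in>{A..<B}. of_bool ((real (n mod Q) + y n) / real Q < t) :: real"
  have "(\<Sum>n\<in>{A..<B}. of_bool (n mod Q < T)) \<le> ?S"
  proof (rule sum_mono)
    fix n
    have "real (n mod Q) + y n < t * real Q" if "n mod Q < T"
    proof -
      have "real (n mod Q) + 1 \<le> real T" using that by linarith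
      with y(2)[of n] T show ?thesis by linarith
    qed
    then show "of_bool (n mod Q < T) \<le> (of_bool ((real (n mod Q) + y n) / real Q < t) :: real)"
      using assms(1) by (auto simp: field_simps)
  qed
  moreover have "?S \<le> (\<Sum>n\<in>{A..<B}. of_bool (n mod Q < Suc T))"
  proof (rule sum_mono)
    fix n
    have "n mod Q < Suc T" if "real (n mod Q) + y n < t * real Q"
    proof -
      have "real (n mod Q) < real (Suc T)" using that y(1)[of n] T by simp
      then show ?thesis by (simp only: of_nat_less_iff)
    qed
    then show "(of_bool ((real (n mod Q) + y n) / real Q < t) :: real) \<le> of_bool (n mod Q < Suc T)"
      using assms(1) by (auto simp: field_simps)
  qed
  moreover have "real (B - A) * t - real B / real Q \<le> real (B - A) * real T / real Q"
  proof -
    have "real (B - A) * (t * real Q) \<le> real (B - A) * (real T + 1)"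
      using T by (intro mult_left_mono) auto
    also have "\<dots> \<le> real (B - A) * real T + real B" by (simp add: distrib_left)
    finally have "(real (B - A) * t * real Q - real B) / real Q \<le> real (B - A) * real T / real Q"
      by (intro divide_right_mono) (simp_all add: mult.assoc)
    then show ?thesis using assms(1) by (simp add: diff_divide_distrib)
  qed
  moreover have "real (B - A) * real (Suc T) / real Q \<le> real (B - A) * t + real B / real Q"
  proof -
    have "real (B - A) * real (Suc T) \<le> real (B - A) * (t * real Q + 1)"
      using T by (intro mult_left_mono) auto
    also have "\<dots> \<le> real (B - A) * t * real Q + real B" by (simp add: distrib_left)
    finally have "real (B - A) * real (Suc T) / real Q
        \<le> (real (B - A) * t * real Q + real B) / real Q"
      by (intro divide_right_mono) simp_all
    then show ?thesis using assms(1) by (simp add: add_divide_distrib)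
  qed
  ultimately have "\<bar>?S - real (B - A) * t\<bar> \<le> 2 * real Q + real B / real Q"
    using count_small_residues_deviation[of Q T A B] count_small_residues_deviation[of Q "Suc T" A B]
      assms(1,2) TQ by linarith
  then show ?thesis by (simp add: sum_subtractf)
qed

section \<open>Deviation of the counting function\<close>

definition deviation :: "nat \<Rightarrow> real \<Rightarrow> real" where
  "deviation N t = (\<Sum>k<N. of_bool (expansion_tail k < t) - t)"

lemma deviation_at_block_start:
  assumes "0 < B" and "0 \<le> t" and "t < 1"
  shows "\<bar>deviation (block_start B) t\<bar> \<le> 24 * real B"
proof -
  let ?R = "num_digits B"
  have "deviation (block_start B) t = (\<Sum>n\<in>{1..<B}. \<Sum>r<num_digits n.
      of_bool (expansion_tail (block_start (Suc n) - Suc r) < t) - t)"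
    unfolding deviation_def by (rule sum_over_blocks[OF assms(1)])
  also have "\<dots> = (\<Sum>r<?R. \<Sum>n\<in>{10 ^ r..<B}.
      of_bool (expansion_tail (block_start (Suc n) - Suc r) < t) - t)"
    by (rule sum_over_blocks_swap)
  also have "\<bar>\<dots>\<bar> \<le> (\<Sum>r<?R. 2 * real (10 ^ Suc r) + real B / real (10 ^ Suc r))"
  proof (rule order_trans[OF sum_abs], rule sum_mono)
    fix r assume "r \<in> {..<?R}"
    then have r: "10 ^ r \<le> B" using assms(1) by (simp add: less_num_digits_iff)
    have "(\<Sum>n\<in>{10 ^ r..<B}. of_bool (expansion_tail (block_start (Suc n) - Suc r) < t) - t)
        = (\<Sum>n\<in>{10 ^ r..<B}. of_bool ((real (n mod 10 ^ Suc r) + expansion_tail (block_start (Suc n)))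
            / real (10 ^ Suc r) < t) - t)"
    proof (rule sum.cong[OF refl])
      fix n :: nat assume n: "n \<in> {10 ^ r..<B}"
      then have "0 < n" by (metis atLeastLessThan_iff less_le_trans zero_less_numeral zero_less_power)
      moreover from this n have "Suc r \<le> num_digits n" by (simp add: less_num_digits_iff Suc_le_eq)
      ultimately have "expansion_tail (block_start (Suc n) - Suc r)
          = (real (n mod 10 ^ Suc r) + expansion_tail (block_start (Suc n))) / real (10 ^ Suc r)"
        using expansion_tail_in_block[of n "Suc r"] by (simp add: field_simps)
      then show "of_bool (expansion_tail (block_start (Suc n) - Suc r) < t) - t
        = of_bool ((real (n mod 10 ^ Suc r) + expansion_tail (block_start (Suc n)))
            / real (10 ^ Suc r) < t) - t"
        by (simp only:)
    qed
    then show "\<bar>\<Sum>n\<in>{10 ^ r..<B}. of_bool (expansion_tail (block_start (Suc n) - Suc r) < t) - t\<bar>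
        \<le> 2 * real (10 ^ Suc r) + real B / real (10 ^ Suc r)"
      using perturbed_residues_deviation[of "10 ^ Suc r" "10 ^ r" B t
          "\<lambda>n. expansion_tail (block_start (Suc n))"] r assms expansion_tail_nonneg expansion_tail_less_1
      by simp
  qed
  also have "\<dots> = 20 * (\<Sum>r<?R. 10 ^ r) + real B * (\<Sum>r<?R. (1 / 10) ^ Suc r)"
    by (simp add: sum.distrib sum_distrib_left power_divide)
  also have "\<dots> \<le> 24 * real B"
  proof -
    have "9 * (\<Sum>r<R. (1 / 10 :: real) ^ Suc r) = 1 - (1 / 10) ^ R" for R
      by (induction R) (auto simp: algebra_simps)
    moreover have "0 \<le> (1 / 10 :: real) ^ ?R" by simp
    ultimately have "(\<Sum>r<?R. (1 / 10 :: real) ^ Suc r) \<le> 1" by (smt (verit))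
    then have "real B * (\<Sum>r<?R. (1 / 10) ^ Suc r) \<le> real B * 1" by (intro mult_left_mono) auto
    then show ?thesis
      using sum_powers_10[of ?R] power_num_digits_le[OF assms(1)] by linarith
  qed
  finally show ?thesis .
qed

text \<open>A cut inside the block of \<open>B\<close> adds at most \<open>num_digits B \<le> B\<close> positions, each of which changes the
  deviation by at most 1.\<close>

lemma deviation_bound:
  assumes "0 < B" "block_start B \<le> N" "N < block_start (Suc B)" and "0 \<le> t" "t < 1"
  shows "\<bar>deviation N t\<bar> \<le> 25 * real B"
proof -
  let ?f = "\<lambda>k. of_bool (expansion_tail k < t) - t"
  have "deviation N t = deviation (block_start B) t + (\<Sum>k\<in>{block_start B..<N}. ?f k)"
    unfolding deviation_def using sum.atLeastLessThan_concat[of 0 "block_start B" N ?f] assms(2)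
    by (simp add: atLeast0LessThan)
  moreover have "\<bar>\<Sum>k\<in>{block_start B..<N}. ?f k\<bar> \<le> (\<Sum>k\<in>{block_start B..<N}. 1)"
    using assms(4,5) by (intro order_trans[OF sum_abs] sum_mono) auto
  moreover have "N - block_start B \<le> B"
    using assms(3) block_start_Suc[OF assms(1)] num_digits_le_self[OF assms(1)] by linarith
  ultimately show ?thesis using deviation_at_block_start[OF assms(1,4,5)] by simp
qed

lemma card_eq_deviation:
  assumes "a < b"
  shows "real (card {n \<in> {1..N}. frac (10 ^ (n - 1) * champernowne) \<in> {a..<b}})
    = deviation N b - deviation N a + real N * (b - a)"
proof -
  have "real (card {n \<in> {1..N}. frac (10 ^ (n - 1) * champernowne) \<in> {a..<b}})
      = (\<Sum>n\<in>{1..N}. of_bool (expansion_tail (n - 1) \<in> {a..<b}))"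
    by (simp add: frac_shift_champernowne sum.If_cases of_bool_def Int_def conj_commute)
  also have "\<dots> = (\<Sum>k<N. of_bool (expansion_tail k \<in> {a..<b}))"
    by (rule sum.reindex_bij_witness[of _ Suc "\<lambda>n. n - 1"]) auto
  also have "\<dots> = (\<Sum>k<N. of_bool (expansion_tail k < b) - of_bool (expansion_tail k < a))"
    using assms by (intro sum.cong) auto
  also have "\<dots> = deviation N b - deviation N a + real N * (b - a)"
    unfolding deviation_def by (simp add: sum_subtractf algebra_simps)
  finally show ?thesis .
qed

section \<open>The discrepancy\<close>

lemma discrepancy_bound:
  assumes "0 < N" "0 < B" "block_start B \<le> N" "N < block_start (Suc B)"
  shows "discrepancy_base10 champernowne N \<le> 50 * real B / real N"
  unfolding discrepancy_base10_def discrepancy_def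
proof (rule cSUP_least)
  have "(0, 1 / 2) \<in> {(a, b). 0 \<le> a \<and> a < b \<and> b < (1::real)}" by simp
  then show "{(a, b). 0 \<le> a \<and> a < b \<and> b < (1::real)} \<noteq> {}" by blast
next
  fix p :: "real \<times> real" assume "p \<in> {(a, b). 0 \<le> a \<and> a < b \<and> b < 1}"
  then obtain a b where p: "p = (a, b)" and ab: "0 \<le> a" "a < b" "b < 1" by blast
  have "real (card {n \<in> {1..N}. frac (10 ^ (n - 1) * champernowne) \<in> {a..<b}}) / real N - (b - a)
      = (deviation N b - deviation N a) / real N"
    unfolding card_eq_deviation[OF ab(2)] using assms(1) by (simp add: field_simps)
  moreover have "\<bar>deviation N b - deviation N a\<bar> \<le> 50 * real B"
    using deviation_bound[OF assms(2-4), of a] deviation_bound[OF assms(2-4), of b] ab by linarith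
  ultimately show "(case p of (a, b) \<Rightarrow>
      \<bar>real (card {n \<in> {1..N}. frac (10 ^ (n - 1) * champernowne) \<in> {a..<b}}) / real N - (b - a)\<bar>)
      \<le> 50 * real B / real N"
    unfolding p by (simp add: divide_right_mono)
qed

text \<open>The link is \<open>num_digits B\<close>: twice it bounds \<open>log N\<close> from above, and \<open>N / B\<close> is at least a
  fifth of it. The lower bound on \<open>N\<close> given by
  \<open>block_start_lower\<close> falls short by \<open>2 * B\<close>, which \<open>B \<le> 2 * N\<close> absorbs; so the estimate
  holds from \<open>N = 1\<close> on.\<close>

lemma log_times_block_index_le:
  assumes "0 < N" "0 < B" "block_start B \<le> N" "N < block_start (Suc B)"
  shows "log 10 (real N) * real B \<le> 10 * real N"
proof -
  let ?R = "num_digits B"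
  have "N \<le> B * ?R" using block_start_upper[OF assms(2)] assms(4) by linarith
  also have "\<dots> \<le> 10 ^ ?R * 10 ^ ?R"
    using num_digits_upper[of B] num_digits_le_self[OF assms(2)] by (intro mult_mono) auto
  finally have "real N \<le> real (10 ^ (2 * ?R))"
    unfolding of_nat_le_iff by (simp add: mult_2 power_add)
  then have "log 10 (real N) \<le> log 10 (10 ^ (2 * ?R))"
    using assms(1) by (simp del: log_pow_cancel)
  then have "log 10 (real N) \<le> 2 * real ?R" by simp
  then have "log 10 (real N) * real B \<le> 2 * (real ?R * real B)"
    using mult_right_mono[of "log 10 (real N)" "2 * real ?R" "real B"] by simp
  moreover have "real ?R * real B \<le> real (block_start B) + 2 * real B"
    using block_start_lower[OF assms(2)] by (simp add: algebra_simps)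
  moreover have "B \<le> 2 * N"
    using le_block_start_Suc[of "B - 1"] assms(1-3) by simp
  ultimately show ?thesis using assms(3) by linarith
qed

theorem theorem1:
  shows "\<exists>K1::real. K1 > 0 \<and>
    (\<forall>\<^sub>\<infinity>N. discrepancy_base10 champernowne N < K1 / log 10 (real N))"
proof (intro exI conjI)
  show "(0::real) < 501" by simp
  have "discrepancy_base10 champernowne N < 501 / log 10 (real N)" if N: "2 \<le> N" for N
  proof -
    obtain B where B: "0 < B" "block_start B \<le> N" "N < block_start (Suc B)"
      by (rule obtain_block)
    have N0: "0 < N" and log: "0 < log 10 (real N)" using N by simp_all
    have "discrepancy_base10 champernowne N \<le> 50 * real B / real N"
      by (rule discrepancy_bound[OF N0 B])
    also have "\<dots> \<le> 500 / log 10 (real N)"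
      using log_times_block_index_le[OF N0 B] N0 log by (simp add: field_simps)
    also have "\<dots> < 501 / log 10 (real N)" using log by (simp add: divide_strict_right_mono)
    finally show ?thesis .
  qed
  then show "\<forall>\<^sub>\<infinity>N. discrepancy_base10 champernowne N < 501 / log 10 (real N)"
    unfolding cofinite_eq_sequentially eventually_sequentially by blast
qed

end
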